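(* Suppose the random walk on $X$ induced by $\mu$ is uniquely ergodic and locally uniformly recurrent on average. Then for every $f\in C_c(X)$, every compact $K\subset X$ and every $\epsilon>0$ there exists $n_0\in\mathbb{N}$ such that for all $n\ge n_0$ and $x\in K$, $$\Big|\frac1n\sum_{k=0}^{n-1}\int_X f\,d(\mu^{*k}*\delta_x)-\int_X f\,dm_X\Big|<\epsilon.$$ Equivalently, the maps $x\mapsto\frac1n\sum_{k=0}^{n-1}\mu^{*k}*\delta_x$ (into probability measures with the weak* topology) converge to $m_X$ uniformly on compact subsets of $X$.
   Context: Standing assumptions: $G$ is a locally compact $\sigma$-compact metrizable group acting ergodically on a locally compact $\sigma$-compact metrizable space $X$ with a $G$-invariant probability measure $m_X$; $\mu$ is a Borel probability measure on $G$. $\mu^{*n}*\delta_x$ is the push-forward of $\mu^{\otimes n}\otimes\delta_x$ under $(g_n,\dots,g_1,x)\mapsto g_n\cdots g_1x$. A probability measure $\nu$ on $X$ is $\mu$-stationary if $\mu*\nu=\nu$; the random walk is uniquely ergodic if $m_X$ is the unique $\mu$-stationary probability measure on $X$. The random walk is locally uniformly recurrent on average if for every compact $K\subset X$ and $\epsilon>0$ there are $n_0$ and a compact $M\subset X$ with $\frac1n\sum_{k=0}^{n-1}\mu^{*k}*\delta_x(M)\ge1-\epsilon$ for all $n\ge n_0$, $x\in K$. *)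

theory Defs
  imports "HOL-Probability.Probability"
begin

text \<open>Locally compact, sigma-compact space (the topology of the type).\<close>
definition lc_sigma_compact :: "'a::topological_space itself \<Rightarrow> bool" where
  "lc_sigma_compact _ \<longleftrightarrow> locally_compact_space (euclidean :: 'a topology) \<and>
     (\<exists>\<K> :: 'a set set. countable \<K> \<and> (\<forall>K\<in>\<K>. compact K) \<and> \<Union>\<K> = UNIV)"

text \<open>A continuous (left) action of the group (written additively, not necessarily
  commutative) on the space.\<close>
definition continuous_action :: "('g::topological_group_add \<Rightarrow> 'x::topological_space \<Rightarrow> 'x) \<Rightarrow> bool" where
  "continuous_action a \<longleftrightarrow> continuous_on UNIV (\<lambda>(g, x). a g x) \<and>
     (\<forall>x. a 0 x = x) \<and> (\<forall>g h x. a (g + h) x = a g (a h x))"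

text \<open>Borel probability measure.\<close>
definition borel_prob :: "'a::topological_space measure \<Rightarrow> bool" where
  "borel_prob M \<longleftrightarrow> prob_space M \<and> sets M = sets borel"

definition invariant_measure :: "('g \<Rightarrow> 'x::topological_space \<Rightarrow> 'x) \<Rightarrow> 'x measure \<Rightarrow> bool" where
  "invariant_measure a m \<longleftrightarrow> (\<forall>g. distr m borel (a g) = m)"

definition ergodic_action :: "('g \<Rightarrow> 'x::topological_space \<Rightarrow> 'x) \<Rightarrow> 'x measure \<Rightarrow> bool" where
  "ergodic_action a m \<longleftrightarrow> (\<forall>A \<in> sets borel. (\<forall>g. a g -` A = A) \<longrightarrow>
     emeasure m A = 0 \<or> emeasure m A = 1)"

text \<open>The composed walk: walk a \<omega> n x = \<omega>(n-1) \<cdot> ... \<cdot> \<omega>(0) \<cdot> x.\<close>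
fun walk :: "('g \<Rightarrow> 'x \<Rightarrow> 'x) \<Rightarrow> (nat \<Rightarrow> 'g) \<Rightarrow> nat \<Rightarrow> 'x \<Rightarrow> 'x" where
  "walk a \<omega> 0 x = x"
| "walk a \<omega> (Suc k) x = a (\<omega> k) (walk a \<omega> k x)"

text \<open>\<mu>^{*n} * \<delta>_x: push-forward of \<mu>^{\<otimes>n} \<otimes> \<delta>_x under
  (g_n,...,g_1,x) \<mapsto> g_n \<cdots> g_1 x.\<close>
definition conv_pow_dirac ::
  "('g::topological_space \<Rightarrow> 'x::topological_space \<Rightarrow> 'x) \<Rightarrow> 'g measure \<Rightarrow> nat \<Rightarrow> 'x \<Rightarrow> 'x measure" where
  "conv_pow_dirac a \<mu> n x = distr (PiM {..<n} (\<lambda>_. \<mu>)) borel (\<lambda>\<omega>. walk a \<omega> n x)"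

text \<open>\<mu> * \<nu>: push-forward of \<mu> \<otimes> \<nu> under the action map.\<close>
definition conv_meas ::
  "('g::topological_space \<Rightarrow> 'x::topological_space \<Rightarrow> 'x) \<Rightarrow> 'g measure \<Rightarrow> 'x measure \<Rightarrow> 'x measure" where
  "conv_meas a \<mu> \<nu> = distr (\<mu> \<Otimes>\<^sub>M \<nu>) borel (\<lambda>(g, y). a g y)"

definition stationary :: "('g::topological_space \<Rightarrow> 'x::topological_space \<Rightarrow> 'x) \<Rightarrow> 'g measure \<Rightarrow> 'x measure \<Rightarrow> bool" where
  "stationary a \<mu> \<nu> \<longleftrightarrow> conv_meas a \<mu> \<nu> = \<nu>"

definition uniquely_ergodic ::
  "('g::topological_space \<Rightarrow> 'x::topological_space \<Rightarrow> 'x) \<Rightarrow> 'g measure \<Rightarrow> 'x measure \<Rightarrow> bool" where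
  "uniquely_ergodic a \<mu> m \<longleftrightarrow> (\<forall>\<nu>. borel_prob \<nu> \<and> stationary a \<mu> \<nu> \<longrightarrow> \<nu> = m)"

definition lur_on_average ::
  "('g::topological_space \<Rightarrow> 'x::topological_space \<Rightarrow> 'x) \<Rightarrow> 'g measure \<Rightarrow> bool" where
  "lur_on_average a \<mu> \<longleftrightarrow> (\<forall>K. compact K \<longrightarrow> (\<forall>\<epsilon>>0. \<exists>n0 M. compact M \<and>
     (\<forall>n\<ge>n0. \<forall>x\<in>K. (1 / real n) * (\<Sum>k<n. measure (conv_pow_dirac a \<mu> k x) M) \<ge> 1 - \<epsilon>)))"

text \<open>Continuous real function with compact support.\<close>
definition Cc :: "('x::topological_space \<Rightarrow> real) set" where
  "Cc = {f. continuous_on UNIV f \<and> compact (closure {x. f x \<noteq> 0})}"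

end

theory Submission
  imports Defs
begin

text \<open>If uniform convergence fails, there are times \<open>n\<^sub>j \<rightarrow> \<infinity>\<close> and points \<open>x\<^sub>j\<close> of the compact set whose
  averages \<open>\<nu>\<^sub>j\<close> stay at distance \<open>\<epsilon>\<close> from \<open>m\<close> on \<open>f\<close>. Recurrence makes \<open>(\<nu>\<^sub>j)\<close> tight, so it has a weak
  limit point \<open>\<nu>\<close> by Prokhorov's theorem. A telescoping sum shows that \<open>\<nu>\<^sub>j\<close> is stationary up to
  \<open>O(1/n\<^sub>j)\<close>, and the Markov operator preserves bounded continuous functions, so \<open>\<nu>\<close> is stationary;
  hence \<open>\<nu> = m\<close>, a contradiction.

  Prokhorov's theorem is proved along a filter instead of a subsequence, which needs no
  separability: Tychonoff's theorem gives a filter along which \<open>\<nu>\<^sub>j(A)\<close> converges for every set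
  \<open>A\<close>, and the resulting finitely additive limit is turned into a measure by inner approximation with
  compact sets.\<close>

subsection \<open>Measures from finitely additive contents\<close>

lemma content_finite_subadditive:
  fixes l :: "'a set \<Rightarrow> real"
  assumes "ring_of_sets \<Omega> \<A>"
  assumes nonneg: "\<And>A. A \<in> \<A> \<Longrightarrow> 0 \<le> l A"
    and additive: "\<And>A B. A \<in> \<A> \<Longrightarrow> B \<in> \<A> \<Longrightarrow> A \<inter> B = {} \<Longrightarrow> l (A \<union> B) = l A + l B"
    and I: "finite I" "C ` I \<subseteq> \<A>"
  shows "l (\<Union>i\<in>I. C i) \<le> (\<Sum>i\<in>I. l (C i))"
  using I
proof (induction I rule: finite_induct)
  case empty
  interpret ring_of_sets \<Omega> \<A> by fact
  show ?case using additive[of "{}" "{}"] by simp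
next
  case (insert i I)
  interpret ring_of_sets \<Omega> \<A> by fact
  have m: "C i \<in> \<A>" "(\<Union>i\<in>I. C i) \<in> \<A>" using insert by auto
  have "l (C i \<union> (\<Union>i\<in>I. C i)) = l (C i \<union> ((\<Union>i\<in>I. C i) - C i))" by simp
  also have "\<dots> = l (C i) + l ((\<Union>i\<in>I. C i) - C i)"
    using m by (intro additive) auto
  also have "\<dots> \<le> l (C i) + (l ((\<Union>i\<in>I. C i) - C i) + l ((\<Union>i\<in>I. C i) \<inter> C i))"
    using nonneg[of "(\<Union>i\<in>I. C i) \<inter> C i"] m by auto
  also have "l ((\<Union>i\<in>I. C i) - C i) + l ((\<Union>i\<in>I. C i) \<inter> C i)
      = l (((\<Union>i\<in>I. C i) - C i) \<union> ((\<Union>i\<in>I. C i) \<inter> C i))"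
    using m by (intro additive[symmetric]) auto
  also have "((\<Union>i\<in>I. C i) - C i) \<union> ((\<Union>i\<in>I. C i) \<inter> C i) = (\<Union>i\<in>I. C i)" by auto
  finally show ?case using insert by simp
qed

lemma compact_subset_UN_open_split:
  fixes U :: "'i \<Rightarrow> 'a::metric_space set"
  assumes C: "compact C" "C \<subseteq> (\<Union>i\<in>I. U i)" and U: "\<And>i. i \<in> I \<Longrightarrow> open (U i)"
  obtains J D where "finite J" "J \<subseteq> I" "\<And>i. i \<in> J \<Longrightarrow> compact (D i)" "\<And>i. i \<in> J \<Longrightarrow> D i \<subseteq> U i"
    "C = (\<Union>i\<in>J. D i)"
proof -
  define S where "S = {(i, x, r). i \<in> I \<and> (r::real) > 0 \<and> cball x r \<subseteq> U i}"
  have "C \<subseteq> (\<Union>(i, x, r)\<in>S. ball x r)"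
  proof
    fix x assume "x \<in> C"
    then obtain i where i: "i \<in> I" "x \<in> U i" using C by auto
    then obtain r where "r > 0" "cball x r \<subseteq> U i" using U open_contains_cball by blast
    then have "(i, x, r) \<in> S" "x \<in> ball x r" using i by (auto simp: S_def)
    then show "x \<in> (\<Union>(i, x, r)\<in>S. ball x r)" by blast
  qed
  then obtain T where T: "T \<subseteq> S" "finite T" "C \<subseteq> (\<Union>(i, x, r)\<in>T. ball x r)"
    using compactE_image[OF \<open>compact C\<close>, of S "\<lambda>(i, x, r). ball x r"] by auto
  define D where "D i = C \<inter> (\<Union>(j, x, r)\<in>{t\<in>T. fst t = i}. cball x r)" for i
  show ?thesis
  proof (rule that[of "fst ` T" D])
    show "finite (fst ` T)" "fst ` T \<subseteq> I" using T by (auto simp: S_def)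
    show "compact (D i)" for i
      unfolding D_def using C T by (intro compact_Int_closed closed_UN) auto
    show "D i \<subseteq> U i" for i
      using T by (auto simp: D_def S_def)
    show "C = (\<Union>i\<in>fst ` T. D i)"
    proof
      show "C \<subseteq> (\<Union>i\<in>fst ` T. D i)"
      proof
        fix y assume "y \<in> C"
        then obtain i x r where "(i, x, r) \<in> T" "y \<in> ball x r" using T by blast
        then have "y \<in> D i"
          using \<open>y \<in> C\<close> unfolding D_def
          by (intro IntI UN_I[of "(i, x, r)"]) auto
        moreover have "i \<in> fst ` T" using \<open>(i, x, r) \<in> T\<close> by force
        ultimately show "y \<in> (\<Union>i\<in>fst ` T. D i)" by blast
      qed
    qed (auto simp: D_def)
  qed
qed

text \<open>The Halmos construction: inner approximation by compact sets makes a finitely additive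
  content countably subadditive on open sets, so that its outer measure is regular and
  Caratheodory's theorem applies.\<close>

lemma inner_regularization_measure:
  fixes l :: "'a::metric_space set \<Rightarrow> real"
  assumes nonneg: "\<And>A. A \<in> sets borel \<Longrightarrow> 0 \<le> l A"
    and additive: "\<And>A B. A \<in> sets borel \<Longrightarrow> B \<in> sets borel \<Longrightarrow> A \<inter> B = {} \<Longrightarrow> l (A \<union> B) = l A + l B"
  obtains \<nu> where "sets \<nu> = sets borel"
    "\<And>U. open U \<Longrightarrow> emeasure \<nu> U = (SUP C\<in>{C. compact C \<and> C \<subseteq> U}. ennreal (l C))"
proof -
  define \<theta> where "\<theta> U = (SUP C\<in>{C. compact C \<and> C \<subseteq> U}. ennreal (l C))" for U
  define \<eta> where "\<eta> A = (INF U\<in>{U. open U \<and> A \<subseteq> U}. \<theta> U)" for A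
  have cb: "compact C \<Longrightarrow> C \<in> sets borel" for C :: "'a set"
    by (intro borel_closed compact_imp_closed)
  have \<theta>_ge: "ennreal (l C) \<le> \<theta> U" if "compact C" "C \<subseteq> U" for C U
    unfolding \<theta>_def using that by (intro SUP_upper) auto
  have \<theta>_mono: "\<theta> U \<le> \<theta> V" if "U \<subseteq> V" for U V
    unfolding \<theta>_def using that by (intro SUP_subset_mono) auto
  have \<eta>_le: "\<eta> A \<le> \<theta> U" if "open U" "A \<subseteq> U" for A U
    unfolding \<eta>_def using that by (intro INF_lower) auto
  have \<eta>_approx: "\<exists>U. open U \<and> A \<subseteq> U \<and> \<theta> U < c" if "\<eta> A < c" for A c
    using that unfolding \<eta>_def INF_less_iff by auto
  have \<eta>_open: "\<eta> U = \<theta> U" if "open U" for U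
  proof (rule antisym)
    show "\<theta> U \<le> \<eta> U" unfolding \<eta>_def by (intro INF_greatest \<theta>_mono) auto
  qed (use that \<eta>_le in auto)
  have l0: "l {} = 0" using additive[of "{}" "{}"] by simp
  have \<theta>_UN: "\<theta> (\<Union>i. U i) \<le> (\<Sum>i. \<theta> (U i))" if U: "\<And>i. open (U i)" for U :: "nat \<Rightarrow> 'a set"
    unfolding \<theta>_def[of "\<Union>i. U i"]
  proof (rule SUP_least)
    fix C assume "C \<in> {C. compact C \<and> C \<subseteq> (\<Union>i. U i)}"
    then have C: "compact C" "C \<subseteq> (\<Union>i\<in>UNIV. U i)" by auto
    obtain J D where J: "finite J" "\<And>i. i \<in> J \<Longrightarrow> compact (D i)" "\<And>i. i \<in> J \<Longrightarrow> D i \<subseteq> U i"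
      "C = (\<Union>i\<in>J. D i)"
      using compact_subset_UN_open_split[OF C U] by metis
    have "l C \<le> (\<Sum>i\<in>J. l (D i))" unfolding J(4)
      by (rule content_finite_subadditive[OF sets.ring_of_sets_axioms nonneg additive])
        (use J cb in auto)
    then have "ennreal (l C) \<le> ennreal (\<Sum>i\<in>J. l (D i))" by (rule ennreal_leI)
    also have "\<dots> = (\<Sum>i\<in>J. ennreal (l (D i)))"
      using J by (intro sum_ennreal[symmetric] nonneg cb) auto
    also have "\<dots> \<le> (\<Sum>i\<in>J. \<theta> (U i))" using J by (intro sum_mono \<theta>_ge)
    also have "\<dots> \<le> (\<Sum>i. \<theta> (U i))" using J by (intro sum_le_suminf) auto
    finally show "ennreal (l C) \<le> (\<Sum>i. \<theta> (U i))" .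
  qed
  have \<eta>_UN: "\<eta> (\<Union>i. A i) \<le> (\<Sum>i. \<eta> (A i))" for A :: "nat \<Rightarrow> 'a set"
  proof (rule ennreal_le_epsilon)
    fix e :: real assume e: "0 < e" "(\<Sum>i. \<eta> (A i)) < top"
    then have "\<eta> (A i) < \<eta> (A i) + e * (1/2)^Suc i" for i
      by (auto simp add: less_top dest!: ennreal_suminf_lessD)
    then have "\<exists>U. open U \<and> A i \<subseteq> U \<and> \<theta> U < \<eta> (A i) + e * (1/2)^Suc i" for i
      using \<eta>_approx by blast
    then obtain U where U: "\<And>i. open (U i)" "\<And>i. A i \<subseteq> U i" "\<And>i. \<theta> (U i) < \<eta> (A i) + e * (1/2)^Suc i"
      by metis
    have "\<eta> (\<Union>i. A i) \<le> \<theta> (\<Union>i. U i)" using U by (intro \<eta>_le) auto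
    also have "\<dots> \<le> (\<Sum>i. \<theta> (U i))" by (rule \<theta>_UN) fact
    also have "\<dots> \<le> (\<Sum>i. \<eta> (A i) + e * (1/2)^Suc i)"
      using U(3) by (intro suminf_le) (auto intro: less_imp_le)
    also have "\<dots> = (\<Sum>i. \<eta> (A i)) + (\<Sum>i. ennreal e * ennreal ((1/2) ^ Suc i))"
      using \<open>0 < e\<close> by (subst suminf_add[symmetric])
                       (auto simp del: ennreal_suminf_cmult simp add: ennreal_mult[symmetric])
    also have "\<dots> = (\<Sum>i. \<eta> (A i)) + e"
      unfolding ennreal_suminf_cmult
      by (subst suminf_ennreal_eq[OF zero_le_power power_half_series]) auto
    finally show "\<eta> (\<Union>i. A i) \<le> (\<Sum>i. \<eta> (A i)) + e" .
  qed
  have \<eta>0: "\<eta> {} = 0" using \<eta>_open[of "{}"] by (simp add: \<theta>_def l0)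
  have \<eta>_mono: "\<eta> A \<le> \<eta> B" if "A \<subseteq> B" for A B
    unfolding \<eta>_def using that by (intro INF_superset_mono) auto
  have oms: "outer_measure_space (Pow UNIV) \<eta>"
    unfolding outer_measure_space_def
    by (auto simp: positive_def increasing_def countably_subadditive_def \<eta>0 intro: \<eta>_mono \<eta>_UN)
  interpret P: sigma_algebra UNIV "Pow UNIV :: 'a set set" by (rule sigma_algebra_Pow)
  have ms: "measure_space UNIV (lambda_system UNIV (Pow UNIV) \<eta>) \<eta>"
    by (rule P.caratheodory_lemma[OF oms])
  have sub: "\<eta> A \<le> \<eta> (A \<inter> U) + \<eta> (A - U)" for A U
  proof -
    have "subadditive (Pow UNIV) \<eta>"
      using oms by (intro P.countably_subadditive_subadditive) (auto simp: outer_measure_space_def)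
    from subadditiveD[OF this, of "A \<inter> U" "A - U"] show ?thesis by (auto simp: Int_Diff_Un)
  qed
  have \<theta>_sup: "\<theta> (W \<inter> U) + \<eta> (W - U) \<le> \<theta> W" if "open W" "open U" for W U
  proof (cases "\<theta> W = top")
    case False
    have "\<theta> (W \<inter> U) + \<eta> (W - U) = (SUP C\<in>{C. compact C \<and> C \<subseteq> W \<inter> U}. ennreal (l C) + \<eta> (W - U))"
      unfolding \<theta>_def by (subst ennreal_SUP_add_left) auto
    also have "\<dots> \<le> \<theta> W"
    proof (rule SUP_least)
      fix C assume C: "C \<in> {C. compact C \<and> C \<subseteq> W \<inter> U}"
      then have "ennreal (l C) + \<eta> (W - U) \<le> ennreal (l C) + \<theta> (W - C)"
        using that by (intro add_left_mono \<eta>_le open_Diff compact_imp_closed) auto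
      also have "\<dots> = (SUP D\<in>{D. compact D \<and> D \<subseteq> W - C}. ennreal (l C) + ennreal (l D))"
        unfolding \<theta>_def by (subst ennreal_SUP_add_right) auto
      also have "\<dots> \<le> \<theta> W"
      proof (rule SUP_least)
        fix D assume D: "D \<in> {D. compact D \<and> D \<subseteq> W - C}"
        have "ennreal (l C) + ennreal (l D) = ennreal (l C + l D)"
          using C D by (intro ennreal_plus[symmetric] nonneg cb) auto
        also have "l C + l D = l (C \<union> D)"
          using C D by (intro additive[symmetric] cb) auto
        also have "ennreal (l (C \<union> D)) \<le> \<theta> W"
          using C D by (intro \<theta>_ge) auto
        finally show "ennreal (l C) + ennreal (l D) \<le> \<theta> W" .
      qed
      finally show "ennreal (l C) + \<eta> (W - U) \<le> \<theta> W" .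
    qed
    finally show ?thesis .
  qed auto
  have open_L: "U \<in> lambda_system UNIV (Pow UNIV) \<eta>" if "open U" for U
    unfolding P.lambda_system_eq
  proof (clarsimp, rule antisym[OF _ sub])
    fix A
    show "\<eta> (A \<inter> U) + \<eta> (A - U) \<le> \<eta> A" unfolding \<eta>_def[of A]
    proof (rule INF_greatest)
      fix W assume W: "W \<in> {W. open W \<and> A \<subseteq> W}"
      then have "\<eta> (A \<inter> U) + \<eta> (A - U) \<le> \<eta> (W \<inter> U) + \<eta> (W - U)"
        by (intro add_mono \<eta>_mono) auto
      also have "\<dots> = \<theta> (W \<inter> U) + \<eta> (W - U)" using W that by (simp add: \<eta>_open open_Int)
      also have "\<dots> \<le> \<theta> W" using W that by (intro \<theta>_sup) auto
      finally show "\<eta> (A \<inter> U) + \<eta> (A - U) \<le> \<theta> W" .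
    qed
  qed
  have "sigma_algebra UNIV (lambda_system UNIV (Pow UNIV) \<eta>)"
    using ms by (simp add: measure_space_def)
  then have "sigma_sets UNIV {U. open U} \<subseteq> lambda_system UNIV (Pow UNIV) \<eta>"
    by (rule sigma_algebra.sigma_sets_subset) (use open_L in auto)
  then have borel_L: "sets borel \<subseteq> lambda_system UNIV (Pow UNIV) \<eta>"
    by (simp add: borel_def)
  have ms': "measure_space UNIV (sets borel) \<eta>"
    using ms borel_L sets.sigma_algebra_axioms[of "borel :: 'a measure"]
    by (auto simp: measure_space_def positive_def countably_additive_def)
  define \<nu> where "\<nu> = measure_of UNIV (sets borel) \<eta>"
  have s: "sets \<nu> = sets borel"
    unfolding \<nu>_def using sets.sigma_sets_eq[of "borel :: 'a measure"] by (simp add: sets_measure_of)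
  have "emeasure \<nu> U = \<theta> U" if "open U" for U
    using emeasure_measure_of_sigma[of UNIV "sets borel" \<eta> U] ms' that \<eta>_open[OF that]
    by (simp add: \<nu>_def measure_space_def)
  with s show ?thesis using that unfolding \<theta>_def by blast
qed

subsection \<open>Weak limits of tight families\<close>

lemma subfilter_pointwise_convergent:
  fixes N :: "'i \<Rightarrow> 'b \<Rightarrow> real"
  assumes F: "F \<noteq> bot" and N: "\<And>i b. N i b \<in> {0..1}"
  obtains G l where "G \<le> F" "G \<noteq> bot" "\<And>b. ((\<lambda>i. N i b) \<longlongrightarrow> l b) G"
proof -
  have "compactin (product_topology (\<lambda>_. euclidean) UNIV) (PiE UNIV (\<lambda>_::'b. {0..1::real}))"
    by (simp add: compactin_PiE)
  then have "compact (PiE UNIV (\<lambda>_::'b. {0..1::real}))"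
    by (simp add: euclidean_product_topology)
  moreover have "filtermap N F \<noteq> bot" using F by (simp add: filtermap_bot_iff)
  moreover have "eventually (\<lambda>x. x \<in> PiE UNIV (\<lambda>_::'b. {0..1::real})) (filtermap N F)"
    unfolding eventually_filtermap using N by (intro always_eventually) auto
  ultimately obtain l where l: "inf (nhds l) (filtermap N F) \<noteq> bot"
    unfolding compact_filter by blast
  define G where "G = inf F (filtercomap N (nhds l))"
  show ?thesis
  proof (rule that[of G l])
    show "G \<le> F" by (simp add: G_def)
    show "G \<noteq> bot"
    proof
      assume "G = bot"
      then have "eventually (\<lambda>_. False) (inf F (filtercomap N (nhds l)))" by (simp add: G_def)
      then obtain Q R where QR: "eventually Q F" "eventually R (filtercomap N (nhds l))"
        "\<And>i. Q i \<Longrightarrow> R i \<Longrightarrow> False" unfolding eventually_inf by blast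
      then obtain S where S: "eventually S (nhds l)" "\<And>i. S (N i) \<Longrightarrow> R i"
        unfolding eventually_filtercomap by blast
      have "eventually (\<lambda>A. \<not> S A) (filtermap N F)"
        unfolding eventually_filtermap using QR(1) by eventually_elim (use QR S in blast)
      then have "eventually (\<lambda>_. False) (inf (nhds l) (filtermap N F))"
        unfolding eventually_inf using S(1) by blast
      then show False using l by (simp add: eventually_False)
    qed
    have "filterlim N (nhds l) G"
      by (rule filterlim_mono[OF filterlim_filtercomap order_refl]) (simp add: G_def)
    then show "((\<lambda>i. N i b) \<longlongrightarrow> l b) G" for b
      using continuous_on_tendsto_compose[OF continuous_on_product_coordinates[of b]] by fastforce
  qed
qed

lemma (in prob_space) layer_sum_bounds:
  assumes f[measurable]: "f \<in> borel_measurable M" and f01: "\<And>x. x \<in> space M \<Longrightarrow> f x \<in> {0..1}"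
    and n: "0 < (n::nat)"
  defines "S \<equiv> (\<Sum>k=1..n. measure M {x\<in>space M. real k / n < f x}) / n"
  shows "S \<le> integral\<^sup>L M f" "integral\<^sup>L M f \<le> S + 1 / n"
proof -
  define h where "h x = (\<Sum>k=1..n. indicator {x\<in>space M. real k / n < f x} x) / real n" for x
  have [measurable]: "{x\<in>space M. real k / n < f x} \<in> sets M" for k
    by measurable
  have int_h: "integrable M h"
    unfolding h_def by (intro integrable_divide Bochner_Integration.integrable_sum integrable_real_indicator)
      (auto simp: emeasure_eq_measure)
  have S: "integral\<^sup>L M h = S"
    unfolding h_def S_def 
    by (subst integral_divide_zero, subst Bochner_Integration.integral_sum)
      (auto simp: Int_def emeasure_eq_measure cong: conj_cong)
  have int_f: "integrable M f"
    by (rule integrable_const_bound[of _ 1]) (use f01 in auto)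
  have h: "h x \<le> f x \<and> f x \<le> h x + 1 / n" if x: "x \<in> space M" for x
  proof -
    define c where "c = nat (\<lceil>n * f x\<rceil> - 1)"
    have nf: "0 \<le> n * f x" "n * f x \<le> n"
      using f01[OF x] by (auto simp: mult_left_le)
    have c: "real c \<le> n * f x" "n * f x \<le> c + 1" unfolding c_def using nf by linarith+
    have "{k\<in>{1..n}. real k / n < f x} = {1..c}"
    proof -
      have "real k / n < f x \<longleftrightarrow> real k < n * f x" for k using n by (simp add: field_simps)
      moreover have "1 \<le> k \<Longrightarrow> real k < n * f x \<longleftrightarrow> k \<le> c" for k
        unfolding c_def by linarith
      moreover have "c \<le> n" unfolding c_def using nf by linarith
      ultimately show ?thesis by auto
    qed
    then have "h x = real c / n"
      unfolding h_def using x by (simp add: indicator_def sum.If_cases Int_def)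
    moreover have "real c / n \<le> f x" "f x \<le> real c / n + 1 / n"
      using c n by (simp_all add: field_simps)
    ultimately show ?thesis by simp
  qed
  show "S \<le> integral\<^sup>L M f"
    unfolding S[symmetric] using h by (intro integral_mono int_h int_f) auto
  have "integral\<^sup>L M f \<le> (\<integral>x. h x + 1 / n \<partial>M)"
    using h by (intro integral_mono Bochner_Integration.integrable_add int_h int_f) auto
  also have "\<dots> = S + 1 / n" using int_h by (simp add: S prob_space)
  finally show "integral\<^sup>L M f \<le> S + 1 / n" .
qed

lemma portmanteau_open_imp_integral:
  fixes N :: "'i \<Rightarrow> 'x::topological_space measure" and f :: "'x \<Rightarrow> real"
  assumes N: "\<And>i. borel_prob (N i)" and \<nu>: "borel_prob \<nu>"
    and open_le: "\<And>U c. open U \<Longrightarrow> c < measure \<nu> U \<Longrightarrow> eventually (\<lambda>i. c < measure (N i) U) G"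
    and f: "continuous_on UNIV f" "bounded (range f)"
  shows "((\<lambda>i. integral\<^sup>L (N i) f) \<longlongrightarrow> integral\<^sup>L \<nu> f) G"
proof -
  have meas: "g \<in> borel_measurable M" if "borel_prob M" "continuous_on UNIV g" for g :: "'x \<Rightarrow> real" and M
    using that borel_measurable_continuous_onI[of g] by (auto simp: borel_prob_def cong: measurable_cong_sets)
  have int: "integrable M g" if M: "borel_prob M" "continuous_on UNIV g" "bounded (range g)"
    for g :: "'x \<Rightarrow> real" and M
  proof -
    interpret prob_space M using M by (simp add: borel_prob_def)
    obtain B where "\<And>x. norm (g x) \<le> B" using M(3) by (auto simp: bounded_iff)
    then show ?thesis by (intro integrable_const_bound[of _ B] meas M) auto
  qed
  have sp: "borel_prob M \<Longrightarrow> space M = UNIV" for M :: "'x measure"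
    unfolding borel_prob_def using sets_eq_imp_space_eq[of M borel] by auto
  have lower: "eventually (\<lambda>i. c < integral\<^sup>L (N i) g) G"
    if g: "continuous_on UNIV g" "\<And>x. g x \<in> {0..1}" and c: "c < integral\<^sup>L \<nu> g" for g :: "'x \<Rightarrow> real" and c
  proof -
    define e where "e = (integral\<^sup>L \<nu> g - c) / 2"
    have e: "e > 0" using c by (simp add: e_def)
    obtain n where n: "0 < n" "1 / real n < e"
      using real_arch_inverse[of e] e by (auto simp: field_simps)
    define U where "U k = {x. real k / n < g x}" for k
    have oU: "open (U k)" for k
      unfolding U_def using g by (intro open_Collect_less continuous_intros)
    have "eventually (\<lambda>i. \<forall>k\<in>{1..n}. measure \<nu> (U k) - e < measure (N i) (U k)) G"
      using e by (intro eventually_ball_finite ballI open_le oU) auto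
    then show ?thesis
    proof eventually_elim
      case (elim i)
      have "integral\<^sup>L \<nu> g \<le> (\<Sum>k=1..n. measure \<nu> (U k)) / n + 1 / n"
        using prob_space.layer_sum_bounds(2)[of \<nu> g n] meas[of \<nu> g] g \<nu> n
        by (simp add: sp[OF \<nu>] U_def borel_prob_def)
      also have "\<dots> \<le> (\<Sum>k=1..n. measure (N i) (U k) + e) / n + 1 / n"
        using elim n by (intro add_right_mono divide_right_mono sum_mono) (auto simp: algebra_simps intro: less_imp_le)
      also have "\<dots> = (\<Sum>k=1..n. measure (N i) (U k)) / n + e + 1 / n"
        using n by (simp add: sum.distrib field_simps)
      finally have "integral\<^sup>L \<nu> g \<le> (\<Sum>k=1..n. measure (N i) (U k)) / n + e + 1 / n" .
      moreover have "(\<Sum>k=1..n. measure (N i) (U k)) / n \<le> integral\<^sup>L (N i) g"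
        using prob_space.layer_sum_bounds(1)[of "N i" g n] meas[of "N i" g] g N[of i] n
        by (simp add: sp[OF N] U_def borel_prob_def)
      ultimately show ?case using n(2) unfolding e_def by argo
    qed
  qed
  have unit: "((\<lambda>i. integral\<^sup>L (N i) g) \<longlongrightarrow> integral\<^sup>L \<nu> g) G"
    if g: "continuous_on UNIV g" "\<And>x. g x \<in> {0..1}" for g :: "'x \<Rightarrow> real"
  proof (rule order_tendstoI)
    have bg: "bounded (range g)" using g by (auto simp: bounded_iff intro!: exI[of _ 1])
    fix c assume c: "integral\<^sup>L \<nu> g < c"
    have eq: "(\<integral>x. 1 - g x \<partial>M) = 1 - integral\<^sup>L M g" if M: "borel_prob M" for M
    proof -
      interpret prob_space M using M by (simp add: borel_prob_def)
      show ?thesis using int[OF M g(1) bg] by (simp add: prob_space)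
    qed
    have "eventually (\<lambda>i. 1 - c < (\<integral>x. 1 - g x \<partial>N i)) G"
      using g c by (intro lower continuous_intros) (auto simp: eq[OF \<nu>])
    then show "eventually (\<lambda>i. integral\<^sup>L (N i) g < c) G"
      by (simp add: eq[OF N])
  qed (use lower g in auto)
  obtain B where B: "B > 0" "\<And>x. norm (f x) \<le> B" using f(2) by (auto simp: bounded_pos)
  define g where "g x = (f x + B) / (2 * B)" for x
  have g01: "g x \<in> {0..1}" for x using B(1) B(2)[of x] by (auto simp: g_def field_simps abs_le_iff)
  have cg: "continuous_on UNIV g" unfolding g_def using B by (intro continuous_intros f) auto
  have eq: "integral\<^sup>L M f = 2 * B * integral\<^sup>L M g - B" if M: "borel_prob M" for M
  proof -
    interpret prob_space M using M by (simp add: borel_prob_def)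
    show ?thesis unfolding g_def using int[OF M f] B(1) by (simp add: prob_space)
  qed
  show ?thesis unfolding eq[OF N] eq[OF \<nu>]
    by (intro tendsto_intros unit cg g01)
qed

theorem prokhorov_subfilter:
  fixes N :: "'i \<Rightarrow> 'x::metric_space measure"
  assumes F: "F \<noteq> bot" and N: "\<And>i. borel_prob (N i)"
    and tight: "\<And>e. e > 0 \<Longrightarrow> \<exists>C. compact C \<and> eventually (\<lambda>i. 1 - e \<le> measure (N i) C) F"
  obtains G \<nu> where "G \<le> F" "G \<noteq> bot" "borel_prob \<nu>"
    "\<And>f :: 'x \<Rightarrow> real. continuous_on UNIV f \<Longrightarrow> bounded (range f) \<Longrightarrow>
       ((\<lambda>i. integral\<^sup>L (N i) f) \<longlongrightarrow> integral\<^sup>L \<nu> f) G"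
proof -
  have prob: "prob_space (N i)" and sets: "sets (N i) = sets borel" for i
    using N by (auto simp: borel_prob_def)
  obtain G l where G: "G \<le> F" "G \<noteq> bot" and l: "\<And>A. ((\<lambda>i. measure (N i) A) \<longlongrightarrow> l A) G"
    using subfilter_pointwise_convergent[of F "\<lambda>i A. measure (N i) A"] F prob
    by (auto simp: prob_space.prob_le_1)
  have l_nonneg: "0 \<le> l A" for A
    using l G by (intro tendsto_lowerbound[OF l]) auto
  have l_le1: "l A \<le> 1" for A
    using l G prob by (intro tendsto_upperbound[OF l]) (auto simp: prob_space.prob_le_1)
  have l_mono: "l A \<le> l B" if "A \<subseteq> B" "B \<in> sets borel" for A B
  proof (rule tendsto_le[OF G(2) l l], intro always_eventually allI)
    fix i interpret prob_space "N i" by (rule prob)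
    show "measure (N i) A \<le> measure (N i) B" using that sets by (intro finite_measure_mono) auto
  qed
  have l_add: "l (A \<union> B) = l A + l B" if "A \<in> sets borel" "B \<in> sets borel" "A \<inter> B = {}" for A B
  proof -
    have "measure (N i) (A \<union> B) = measure (N i) A + measure (N i) B" for i
    proof -
      interpret prob_space "N i" by (rule prob)
      show ?thesis using that sets by (intro finite_measure_Union) auto
    qed
    then have "((\<lambda>i. measure (N i) (A \<union> B)) \<longlongrightarrow> l A + l B) G"
      by (simp only:) (intro tendsto_intros l)
    then show ?thesis using l[of "A \<union> B"] G(2) tendsto_unique by blast
  qed
  obtain \<nu> where sets\<nu>: "sets \<nu> = sets borel"
    and \<nu>: "\<And>U. open U \<Longrightarrow> emeasure \<nu> U = (SUP C\<in>{C. compact C \<and> C \<subseteq> U}. ennreal (l C))"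
    using inner_regularization_measure[of l] l_nonneg l_add by metis
  have space\<nu>: "space \<nu> = UNIV" using sets_eq_imp_space_eq[OF sets\<nu>] by simp
  have "emeasure \<nu> UNIV = 1"
  proof (rule antisym)
    show "emeasure \<nu> UNIV \<le> 1"
      unfolding \<nu>[OF open_UNIV] using l_le1 by (intro SUP_least) (auto simp: ennreal_le_1)
    show "1 \<le> emeasure \<nu> UNIV"
    proof (rule ennreal_le_epsilon)
      fix e :: real assume e: "0 < e"
      obtain C where C: "compact C" "eventually (\<lambda>i. 1 - e \<le> measure (N i) C) F"
        using tight[OF e] by blast
      have "1 - e \<le> l C"
        by (rule tendsto_lowerbound[OF l _ G(2)]) (use C(2) G(1) in \<open>auto simp: le_filter_def\<close>)
      then have "1 \<le> ennreal (l C) + ennreal e"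
        using l_nonneg[of C] e by (simp flip: ennreal_plus)
      also have "\<dots> \<le> emeasure \<nu> UNIV + ennreal e"
        unfolding \<nu>[OF open_UNIV] using C by (intro add_right_mono SUP_upper) auto
      finally show "1 \<le> emeasure \<nu> UNIV + ennreal e" .
    qed
  qed
  then have prob\<nu>: "prob_space \<nu>" by (intro prob_spaceI) (simp add: space\<nu>)
  then interpret \<nu>: prob_space \<nu> .
  have bp: "borel_prob \<nu>" using prob\<nu> sets\<nu> by (simp add: borel_prob_def)
  have le: "measure \<nu> U \<le> l U" if "open U" for U
  proof -
    have "emeasure \<nu> U \<le> ennreal (l U)"
      unfolding \<nu>[OF that] using that by (intro SUP_least ennreal_leI l_mono) auto
    then show ?thesis using l_nonneg by (simp add: \<nu>.emeasure_eq_measure)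
  qed
  have open_le: "eventually (\<lambda>i. c < measure (N i) U) G" if "open U" "c < measure \<nu> U" for U c
    using that le[of U] by (intro order_tendstoD(1)[OF l]) auto
  show ?thesis
    by (rule that[OF G bp portmanteau_open_imp_integral[OF N bp open_le]])
qed

lemma borel_prob_eqI_integral:
  fixes M N :: "'x::metric_space measure"
  assumes M: "borel_prob M" and N: "borel_prob N"
    and eq: "\<And>f :: 'x \<Rightarrow> real. continuous_on UNIV f \<Longrightarrow> bounded (range f) \<Longrightarrow> integral\<^sup>L M f = integral\<^sup>L N f"
  shows "M = N"
proof -
  interpret M: prob_space M using M by (simp add: borel_prob_def)
  interpret N: prob_space N using N by (simp add: borel_prob_def)
  have closed_eq: "emeasure M C = emeasure N C" if C: "closed C" for C
  proof (cases "C = {}")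
    case False
    define h where "h n x = max 0 (1 - real n * infdist x C)" for n x
    have cont: "continuous_on UNIV (h n)" for n
      unfolding h_def by (intro continuous_intros)
    have bound: "norm (h n x) \<le> 1" for n x
      unfolding h_def using infdist_nonneg[of x C] by auto
    have lim: "(\<lambda>n. h n x) \<longlonglongrightarrow> indicator C x" for x
    proof (cases "x \<in> C")
      case True
      then show ?thesis by (simp add: h_def)
    next
      case False
      then have "infdist x C > 0" using C \<open>C \<noteq> {}\<close> in_closed_iff_infdist_zero[of C x] infdist_nonneg[of x C] by auto
      then obtain n0 where n0: "1 < real n0 * infdist x C" using reals_Archimedean3 by blast
      have "h n x = 0" if "n \<ge> n0" for n
      proof -
        have "real n0 * infdist x C \<le> real n * infdist x C"
          using that by (intro mult_right_mono infdist_nonneg) auto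
        then show ?thesis using n0 by (simp add: h_def)
      qed
      then have "eventually (\<lambda>n. h n x = 0) sequentially" by (auto simp: eventually_sequentially)
      then show ?thesis using False by (simp add: tendsto_eventually)
    qed
    have conv: "(\<lambda>n. integral\<^sup>L P (h n)) \<longlonglongrightarrow> measure P C" if P: "borel_prob P" for P
    proof -
      interpret P: prob_space P using P by (simp add: borel_prob_def)
      have [measurable_cong]: "sets P = sets borel" using P by (simp add: borel_prob_def)
      have C': "C \<in> sets P" using C by simp
      have "(\<lambda>n. integral\<^sup>L P (h n)) \<longlonglongrightarrow> integral\<^sup>L P (indicator C :: 'x \<Rightarrow> real)"
      proof (rule integral_dominated_convergence[where w="\<lambda>_. 1"])
        show "h n \<in> borel_measurable P" for n
          using borel_measurable_continuous_onI[OF cont[of n]] by simp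
      qed (use lim bound C' in auto)
      then show ?thesis using C' by (simp add: Int_absorb2 sets.sets_into_space)
    qed
    have "integral\<^sup>L M (h n) = integral\<^sup>L N (h n)" for n
      using bound by (intro eq cont) (auto simp: bounded_iff)
    then have "measure M C = measure N C"
      using conv[OF M] conv[OF N] LIMSEQ_unique by simp
    then show ?thesis by (simp add: M.emeasure_eq_measure N.emeasure_eq_measure)
  qed simp
  show ?thesis
  proof (rule measure_eqI_generator_eq[where E="Collect closed" and \<Omega>=UNIV and A="\<lambda>_. UNIV"])
    show "sets M = sigma_sets UNIV (Collect closed)" "sets N = sigma_sets UNIV (Collect closed)"
      using M N by (auto simp: borel_prob_def borel_eq_closed)
  qed (use closed_eq in \<open>auto simp: Int_stable_def\<close>)
qed

lemma sigma_compact_imp_countable_basis: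
  fixes \<K> :: "'a::metric_space set set"
  assumes "countable \<K>" "\<And>K. K \<in> \<K> \<Longrightarrow> compact K" "\<Union>\<K> = UNIV"
  obtains B :: "'a set set" where "countable B" "topological_basis B"
proof -
  have "\<exists>T. finite T \<and> K \<subseteq> (\<Union>x\<in>T. ball x (1 / Suc n))" if "K \<in> \<K>" for K n
  proof -
    have "K \<subseteq> (\<Union>x\<in>K. ball x (1 / Suc n))" by force
    then show ?thesis
      by (rule compactE_image[OF assms(2)[OF that], of K "\<lambda>x. ball x (1 / Suc n)", rotated]) auto
  qed
  then obtain T where T: "\<And>K n. K \<in> \<K> \<Longrightarrow> finite (T K n)"
    "\<And>K n. K \<in> \<K> \<Longrightarrow> K \<subseteq> (\<Union>x\<in>T K n. ball x (1 / Suc n))" by metis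
  define B where "B = (\<Union>K\<in>\<K>. \<Union>n. (\<lambda>x. ball x (1 / Suc n)) ` T K n)"
  show ?thesis
  proof (rule that[of B])
    show "countable B"
      unfolding B_def using assms(1) T(1) by (intro countable_UN countable_image) (simp_all add: countable_finite)
    show "topological_basis B"
    proof (rule topological_basisI)
      show "open U" if "U \<in> B" for U using that by (auto simp: B_def)
      fix U :: "'a set" and y assume "open U" "y \<in> U"
      then obtain e where e: "e > 0" "ball y e \<subseteq> U" using open_contains_ball by blast
      obtain n where n: "1 / Suc n < e / 2" using nat_approx_posE[of "e / 2"] e by auto
      obtain K where "K \<in> \<K>" "y \<in> K" using assms(3) by blast
      then obtain x where x: "x \<in> T K n" "y \<in> ball x (1 / Suc n)" using T(2)[of K n] by blast
      have "ball x (1 / Suc n) \<subseteq> ball y e"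
      proof
        fix z assume "z \<in> ball x (1 / Suc n)"
        then show "z \<in> ball y e"
          using x(2) n dist_triangle2[of y z x] by (simp add: dist_commute)
      qed
      then show "\<exists>V\<in>B. y \<in> V \<and> V \<subseteq> U"
        using x \<open>K \<in> \<K>\<close> e by (intro bexI[of _ "ball x (1 / Suc n)"]) (auto simp: B_def)
    qed
  qed
qed

text \<open>The library lemma \<open>borel_prod\<close> needs \<open>second_countable_topology\<close> as a type class, which is
  not available here; a countable basis on each factor suffices.\<close>

lemma open_in_sets_pair_borel:
  fixes A :: "'a::topological_space set set" and B :: "'b::topological_space set set"
  assumes A: "countable A" "topological_basis A" and B: "countable B" "topological_basis B"
    and W: "open (W :: ('a \<times> 'b) set)"
  shows "W \<in> sets (borel \<Otimes>\<^sub>M borel)"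
proof -
  define R where "R = {p \<in> A \<times> B. fst p \<times> snd p \<subseteq> W}"
  have "W = (\<Union>(U, V)\<in>R. U \<times> V)"
  proof
    show "W \<subseteq> (\<Union>(U, V)\<in>R. U \<times> V)"
    proof
      fix p assume "p \<in> W"
      with W obtain S T where ST: "open S" "open T" "p \<in> S \<times> T" "S \<times> T \<subseteq> W"
        by (rule open_prod_elim)
      have p: "fst p \<in> S" "snd p \<in> T" using ST(3) by auto
      obtain U where U: "U \<in> A" "fst p \<in> U" "U \<subseteq> S"
        using topological_basisE[OF A(2) ST(1) p(1)] by blast
      obtain V where V: "V \<in> B" "snd p \<in> V" "V \<subseteq> T"
        using topological_basisE[OF B(2) ST(2) p(2)] by blast
      from U V have "(U, V) \<in> R" "p \<in> U \<times> V"
        using ST(4) by (auto simp: R_def mem_Times_iff)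
      then show "p \<in> (\<Union>(U, V)\<in>R. U \<times> V)" by blast
    qed
  qed (auto simp: R_def)
  moreover have "countable R"
    using A B by (intro countable_subset[of R "A \<times> B"]) (auto simp: R_def)
  moreover have "U \<times> V \<in> sets (borel \<Otimes>\<^sub>M borel)" if "(U, V) \<in> R" for U V
    using that A(2) B(2) by (auto simp: R_def topological_basis_open)
  ultimately show ?thesis by (auto intro!: sets.countable_UN')
qed

subsection \<open>Random walks\<close>

locale random_walk =
  fixes a :: "'g::metric_space \<Rightarrow> 'x::metric_space \<Rightarrow> 'x" and \<mu> :: "'g measure"
  assumes prob_\<mu>: "prob_space \<mu>" and sets_\<mu>[measurable_cong]: "sets \<mu> = sets borel"
    and action_cont: "continuous_on UNIV (\<lambda>(g, x). a g x)"
    and action_meas[measurable]: "(\<lambda>(g, x). a g x) \<in> borel \<Otimes>\<^sub>M borel \<rightarrow>\<^sub>M borel"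
begin

sublocale \<mu>: prob_space \<mu> by (rule prob_\<mu>)

definition markov_op :: "('x \<Rightarrow> real) \<Rightarrow> 'x \<Rightarrow> real" where
  "markov_op f x = (\<integral>g. f (a g x) \<partial>\<mu>)"

lemma continuous_action_left: "continuous_on UNIV (\<lambda>g. a g x)"
proof -
  have "continuous_on UNIV (\<lambda>g :: 'g. (g, x))" by (intro continuous_intros)
  from continuous_on_compose2[OF action_cont this] show ?thesis by simp
qed

lemma continuous_action_right: "continuous_on UNIV (a g)"
proof -
  have "continuous_on UNIV (\<lambda>x :: 'x. (g, x))" by (intro continuous_intros)
  from continuous_on_compose2[OF action_cont this] show ?thesis by simp
qed

lemma continuous_markov_op:
  assumes f: "continuous_on UNIV f" "bounded (range f)"
  shows "continuous_on UNIV (markov_op f)"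
proof (rule continuous_on_sequentiallyI)
  fix u :: "nat \<Rightarrow> 'x" and x assume u: "u \<longlonglongrightarrow> x"
  obtain B where B: "\<And>x. norm (f x) \<le> B" using f(2) by (auto simp: bounded_iff)
  have meas: "(\<lambda>g. f (a g y)) \<in> borel_measurable \<mu>" for y
    using borel_measurable_continuous_onI[OF continuous_on_compose2[OF f(1) continuous_action_left[of y]]]
    by simp
  show "(\<lambda>n. markov_op f (u n)) \<longlonglongrightarrow> markov_op f x"
    unfolding markov_op_def
  proof (rule integral_dominated_convergence[where w="\<lambda>_. B"])
    have "continuous_on UNIV (\<lambda>x. f (a g x))" for g
      using continuous_on_compose2[OF f(1) continuous_action_right[of g]] by simp
    then show "AE g in \<mu>. (\<lambda>n. f (a g (u n))) \<longlonglongrightarrow> f (a g x)"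
      using u by (auto simp: continuous_on_sequentially comp_def)
  qed (use B meas in auto)
qed

lemma norm_markov_op_le:
  assumes "\<And>x. \<bar>f x\<bar> \<le> B"
  shows "\<bar>markov_op f x\<bar> \<le> B"
proof (cases "integrable \<mu> (\<lambda>g. f (a g x))")
  case True
  have "\<bar>markov_op f x\<bar> \<le> (\<integral>g. \<bar>f (a g x)\<bar> \<partial>\<mu>)"
    unfolding markov_op_def using integral_abs_bound by blast
  also have "\<dots> \<le> (\<integral>g. B \<partial>\<mu>)" using True assms by (intro integral_mono) auto
  finally show ?thesis by (simp add: \<mu>.prob_space)
next
  case False
  then show ?thesis using assms[of x] by (simp add: markov_op_def not_integrable_integral_eq)
qed

lemma measurable_walk:
  assumes "{..<k} \<subseteq> I"
  shows "(\<lambda>\<omega>. walk a \<omega> k x) \<in> PiM I (\<lambda>_. \<mu>) \<rightarrow>\<^sub>M borel"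
  using assms
proof (induction k)
  case (Suc k)
  then have [measurable]: "(\<lambda>\<omega>. walk a \<omega> k x) \<in> PiM I (\<lambda>_. \<mu>) \<rightarrow>\<^sub>M borel"
    by (simp add: lessThan_Suc)
  have "(\<lambda>\<omega>. \<omega> k) \<in> PiM I (\<lambda>_. \<mu>) \<rightarrow>\<^sub>M \<mu>"
    using Suc.prems by (intro measurable_component_singleton) auto
  then have [measurable]: "(\<lambda>\<omega>. \<omega> k) \<in> PiM I (\<lambda>_. \<mu>) \<rightarrow>\<^sub>M borel"
    by (simp cong: measurable_cong_sets add: sets_\<mu>)
  have "(\<lambda>\<omega>. (\<lambda>(g, x). a g x) (\<omega> k, walk a \<omega> k x)) \<in> PiM I (\<lambda>_. \<mu>) \<rightarrow>\<^sub>M borel"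
    by measurable
  then show ?case by simp
qed simp

lemma borel_prob_conv_pow: "borel_prob (conv_pow_dirac a \<mu> k x)"
proof -
  interpret P: product_prob_space "\<lambda>_. \<mu>" "{..<k}" by unfold_locales
  show ?thesis
    unfolding borel_prob_def conv_pow_dirac_def
    by (auto intro!: P.prob_space_distr measurable_walk)
qed

lemma walk_upd_ge: "k \<le> j \<Longrightarrow> walk a (fun_upd \<omega> j g) k x = walk a \<omega> k x"
  by (induction k) auto

lemma integral_conv_pow_Suc:
  assumes f: "continuous_on UNIV f" "bounded (range f)"
  shows "integral\<^sup>L (conv_pow_dirac a \<mu> (Suc k) x) f = integral\<^sup>L (conv_pow_dirac a \<mu> k x) (markov_op f)"
proof -
  interpret P: product_prob_space "\<lambda>_. \<mu>" UNIV by unfold_locales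
  interpret Q: product_prob_space "\<lambda>_. \<mu>" "{..<Suc k}" by unfold_locales
  obtain B where B: "\<And>x. norm (f x) \<le> B" using f(2) by (auto simp: bounded_iff)
  have [measurable]: "f \<in> borel_measurable borel" using f(1) by (rule borel_measurable_continuous_onI)
  have [measurable]: "markov_op f \<in> borel_measurable borel"
    using continuous_markov_op[OF f] by (rule borel_measurable_continuous_onI)
  have "(\<lambda>\<omega>. f (walk a \<omega> (Suc k) x)) \<in> borel_measurable (PiM {..<Suc k} (\<lambda>_. \<mu>))"
    by (rule measurable_compose[OF measurable_walk[OF order_refl]]) simp
  then have int: "integrable (PiM {..<Suc k} (\<lambda>_. \<mu>)) (\<lambda>\<omega>. f (walk a \<omega> (Suc k) x))"
    using B by (intro Q.integrable_const_bound[of _ B]) (auto simp del: walk.simps)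
  have ins: "{..<Suc k} = insert k {..<k}" by auto
  have "integral\<^sup>L (conv_pow_dirac a \<mu> (Suc k) x) f = (\<integral>\<omega>. f (walk a \<omega> (Suc k) x) \<partial>PiM {..<Suc k} (\<lambda>_. \<mu>))"
    unfolding conv_pow_dirac_def by (rule integral_distr[OF measurable_walk]) auto
  also have "\<dots> = (\<integral>\<omega>. (\<integral>g. f (walk a (fun_upd \<omega> k g) (Suc k) x) \<partial>\<mu>) \<partial>PiM {..<k} (\<lambda>_. \<mu>))"
    unfolding ins by (rule P.product_integral_insert) (use int in \<open>simp_all add: ins del: walk.simps\<close>)
  also have "\<dots> = (\<integral>\<omega>. markov_op f (walk a \<omega> k x) \<partial>PiM {..<k} (\<lambda>_. \<mu>))"
    by (simp add: walk_upd_ge markov_op_def)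
  also have "\<dots> = integral\<^sup>L (conv_pow_dirac a \<mu> k x) (markov_op f)"
    unfolding conv_pow_dirac_def by (rule integral_distr[OF measurable_walk, symmetric]) auto
  finally show ?thesis .
qed

definition walk_average :: "nat \<Rightarrow> 'x \<Rightarrow> 'x measure" where
  "walk_average n x = measure_pmf (pmf_of_set {..<n}) \<bind> (\<lambda>k. conv_pow_dirac a \<mu> k x)"

lemma conv_pow_kernel:
  "(\<lambda>k. conv_pow_dirac a \<mu> k x) \<in> measure_pmf p \<rightarrow>\<^sub>M subprob_algebra borel"
proof -
  have "conv_pow_dirac a \<mu> k x \<in> space (subprob_algebra borel)" for k
    using borel_prob_conv_pow[of k x]
    by (simp add: space_subprob_algebra borel_prob_def prob_space_imp_subprob_space)
  then show ?thesis by simp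
qed

lemma borel_prob_walk_average: "borel_prob (walk_average n x)"
proof -
  have "prob_space (conv_pow_dirac a \<mu> k x)" "sets (conv_pow_dirac a \<mu> k x) = sets borel" for k
    using borel_prob_conv_pow[of k x] by (simp_all add: borel_prob_def)
  then show ?thesis
    unfolding borel_prob_def walk_average_def
    by (intro conjI measure_pmf.prob_space_bind[OF _ conv_pow_kernel] sets_bind) simp_all
qed

lemma integral_walk_average:
  assumes n: "0 < n" and f: "f \<in> borel_measurable borel" "\<And>x. \<bar>f x\<bar> \<le> B"
  shows "integral\<^sup>L (walk_average n x) f = 1 / real n * (\<Sum>k<n. integral\<^sup>L (conv_pow_dirac a \<mu> k x) f)"
proof -
  have "emeasure (conv_pow_dirac a \<mu> k x) (space (conv_pow_dirac a \<mu> k x)) \<le> ennreal 1" for k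
    using borel_prob_conv_pow[of k x] by (simp add: borel_prob_def prob_space.emeasure_space_1)
  then have "integral\<^sup>L (walk_average n x) f
      = (\<integral>k. integral\<^sup>L (conv_pow_dirac a \<mu> k x) f \<partial>measure_pmf (pmf_of_set {..<n}))"
    unfolding walk_average_def
    by (intro integral_bind[where K=borel and B=B and B'=1] f conv_pow_kernel measure_pmf.finite_measure_axioms)
       auto
  also have "\<dots> = 1 / real n * (\<Sum>k<n. integral\<^sup>L (conv_pow_dirac a \<mu> k x) f)"
    using n by (subst integral_pmf_of_set) auto
  finally show ?thesis .
qed

lemma measure_walk_average:
  assumes n: "0 < n" and A: "A \<in> sets borel"
  shows "measure (walk_average n x) A = 1 / real n * (\<Sum>k<n. measure (conv_pow_dirac a \<mu> k x) A)"
proof -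
  have "integral\<^sup>L M (indicator A :: 'x \<Rightarrow> real) = measure M A" if "borel_prob M" for M
    using that A sets.sets_into_space[of A M] by (simp add: borel_prob_def Int_absorb2)
  then show ?thesis
    using integral_walk_average[OF n, of "indicator A" 1 x] A borel_prob_conv_pow borel_prob_walk_average
    by simp
qed

lemma markov_op_walk_average:
  assumes n: "0 < n" and f: "continuous_on UNIV f" "\<And>x. \<bar>f x\<bar> \<le> B"
  shows "\<bar>integral\<^sup>L (walk_average n x) (markov_op f) - integral\<^sup>L (walk_average n x) f\<bar> \<le> 2 * B / n"
proof -
  define I where "I k = integral\<^sup>L (conv_pow_dirac a \<mu> k x) f" for k
  have bd: "bounded (range f)" using f by (auto simp: bounded_iff)
  have I_le: "\<bar>I k\<bar> \<le> B" for k
  proof -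
    interpret prob_space "conv_pow_dirac a \<mu> k x"
      using borel_prob_conv_pow by (simp add: borel_prob_def)
    have [measurable]: "f \<in> borel_measurable (conv_pow_dirac a \<mu> k x)"
      using borel_measurable_continuous_onI[OF f(1)] by (simp add: conv_pow_dirac_def)
    have int: "integrable (conv_pow_dirac a \<mu> k x) f"
      using f by (intro integrable_const_bound[of _ B]) auto
    have "\<bar>I k\<bar> \<le> (\<integral>y. \<bar>f y\<bar> \<partial>conv_pow_dirac a \<mu> k x)"
      unfolding I_def using integral_abs_bound by blast
    also have "\<dots> \<le> (\<integral>y. B \<partial>conv_pow_dirac a \<mu> k x)" using int f by (intro integral_mono) auto
    finally show ?thesis by (simp add: prob_space)
  qed
  have "integral\<^sup>L (walk_average n x) (markov_op f) = 1 / real n * (\<Sum>k<n. I (Suc k))"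
    unfolding I_def integral_conv_pow_Suc[OF f(1) bd]
    using borel_measurable_continuous_onI[OF continuous_markov_op[OF f(1) bd]] norm_markov_op_le[of f, OF f(2)]
    by (intro integral_walk_average n) auto
  moreover have "integral\<^sup>L (walk_average n x) f = 1 / real n * (\<Sum>k<n. I k)"
    unfolding I_def using borel_measurable_continuous_onI[OF f(1)] f(2) by (intro integral_walk_average n) auto
  ultimately have "integral\<^sup>L (walk_average n x) (markov_op f) - integral\<^sup>L (walk_average n x) f
      = 1 / real n * (\<Sum>k<n. I (Suc k) - I k)"
    by (simp add: sum_subtractf right_diff_distrib)
  also have "\<dots> = (I n - I 0) / n"
    by (simp add: sum_lessThan_telescope)
  also have "\<bar>\<dots>\<bar> \<le> 2 * B / n"
    using I_le[of n] I_le[of 0] n by (auto simp: abs_le_iff divide_right_mono intro!: divide_right_mono)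
  finally show ?thesis .
qed

lemma stationary_if_markov_invariant:
  assumes \<nu>: "borel_prob \<nu>"
    and inv: "\<And>f. continuous_on UNIV f \<Longrightarrow> bounded (range f) \<Longrightarrow> integral\<^sup>L \<nu> (markov_op f) = integral\<^sup>L \<nu> f"
  shows "stationary a \<mu> \<nu>"
  unfolding stationary_def
proof (rule borel_prob_eqI_integral[OF _ \<nu>])
  interpret \<nu>: prob_space \<nu> using \<nu> by (simp add: borel_prob_def)
  have [measurable_cong]: "sets \<nu> = sets borel" using \<nu> by (simp add: borel_prob_def)
  interpret pair_prob_space \<mu> \<nu> ..
  have am: "(\<lambda>(g, y). a g y) \<in> \<mu> \<Otimes>\<^sub>M \<nu> \<rightarrow>\<^sub>M borel" by measurable
  show "borel_prob (conv_meas a \<mu> \<nu>)"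
    unfolding borel_prob_def conv_meas_def using prob_space_distr[OF am] by simp
  fix f :: "'x \<Rightarrow> real" assume f: "continuous_on UNIV f" "bounded (range f)"
  obtain B where B: "\<And>x. norm (f x) \<le> B" using f(2) by (auto simp: bounded_iff)
  have fm[measurable]: "f \<in> borel_measurable borel" using f(1) by (rule borel_measurable_continuous_onI)
  have "(\<lambda>p. f (case p of (g, y) \<Rightarrow> a g y)) \<in> borel_measurable (\<mu> \<Otimes>\<^sub>M \<nu>)"
    by (rule measurable_compose[OF am fm])
  then have int: "integrable (\<mu> \<Otimes>\<^sub>M \<nu>) (\<lambda>(g, y). f (a g y))"
    using B by (intro integrable_const_bound[of _ B]) (auto simp: split_beta)
  have "integral\<^sup>L (conv_meas a \<mu> \<nu>) f = (\<integral>(g, y). f (a g y) \<partial>(\<mu> \<Otimes>\<^sub>M \<nu>))"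
    unfolding conv_meas_def by (subst integral_distr[OF am]) (auto simp: case_prod_unfold)
  also have "\<dots> = integral\<^sup>L \<nu> (markov_op f)"
    unfolding markov_op_def using integral_snd[OF int] by simp
  also have "\<dots> = integral\<^sup>L \<nu> f" by (rule inv) fact+
  finally show "integral\<^sup>L (conv_meas a \<mu> \<nu>) f = integral\<^sup>L \<nu> f" .
qed

lemma stationary_limit_of_averages:
  assumes G: "G \<noteq> bot" "filterlim n at_top G" and \<nu>: "borel_prob \<nu>"
    and lim: "\<And>f :: 'x \<Rightarrow> real. continuous_on UNIV f \<Longrightarrow> bounded (range f) \<Longrightarrow>
       ((\<lambda>i. integral\<^sup>L (walk_average (n i) (x i)) f) \<longlongrightarrow> integral\<^sup>L \<nu> f) G"
  shows "stationary a \<mu> \<nu>"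
proof (rule stationary_if_markov_invariant[OF \<nu>])
  fix f :: "'x \<Rightarrow> real" assume f: "continuous_on UNIV f" "bounded (range f)"
  obtain B where B: "\<And>x. \<bar>f x\<bar> \<le> B" using f(2) by (auto simp: bounded_iff)
  have "((\<lambda>i. integral\<^sup>L (walk_average (n i) (x i)) (markov_op f) - integral\<^sup>L (walk_average (n i) (x i)) f)
      \<longlongrightarrow> integral\<^sup>L \<nu> (markov_op f) - integral\<^sup>L \<nu> f) G"
    using norm_markov_op_le[of f, OF B]
    by (intro tendsto_diff lim f continuous_markov_op) (auto simp: bounded_iff)
  moreover have "((\<lambda>i. integral\<^sup>L (walk_average (n i) (x i)) (markov_op f) - integral\<^sup>L (walk_average (n i) (x i)) f)
      \<longlongrightarrow> 0) G"
  proof (rule Lim_null_comparison)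
    have "eventually (\<lambda>i. 0 < n i) G"
      using G(2)[unfolded filterlim_at_top, rule_format, of 1] by eventually_elim simp
    then show "eventually (\<lambda>i. norm (integral\<^sup>L (walk_average (n i) (x i)) (markov_op f)
        - integral\<^sup>L (walk_average (n i) (x i)) f) \<le> 2 * B / real (n i)) G"
      by eventually_elim (use markov_op_walk_average[OF _ f(1) B] in auto)
    show "((\<lambda>i. 2 * B / real (n i)) \<longlongrightarrow> 0) G"
      by (intro real_tendsto_divide_at_top[OF tendsto_const] filterlim_compose[OF filterlim_real_sequentially G(2)])
  qed
  ultimately show "integral\<^sup>L \<nu> (markov_op f) = integral\<^sup>L \<nu> f"
    using tendsto_unique[OF G(1)] by fastforce
qed

theorem averages_uniformly_convergent:
  assumes ue: "uniquely_ergodic a \<mu> m" and rec: "lur_on_average a \<mu>"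
    and f: "continuous_on UNIV f" "bounded (range f)" and K: "compact K" and e: "0 < \<epsilon>"
  shows "\<exists>n0. \<forall>n\<ge>n0. \<forall>x\<in>K.
    \<bar>(1 / real n) * (\<Sum>k<n. integral\<^sup>L (conv_pow_dirac a \<mu> k x) f) - integral\<^sup>L m f\<bar> < \<epsilon>"
proof (rule ccontr)
  obtain B where B: "\<And>x. \<bar>f x\<bar> \<le> B" using f(2) by (auto simp: bounded_iff)
  assume "\<not> ?thesis"
  then have "\<forall>j. \<exists>n x. n \<ge> Suc j \<and> x \<in> K \<and>
      \<bar>(1 / real n) * (\<Sum>k<n. integral\<^sup>L (conv_pow_dirac a \<mu> k x) f) - integral\<^sup>L m f\<bar> \<ge> \<epsilon>"
    by (metis not_less)
  then obtain n x where nx: "\<And>j. n j \<ge> Suc j" "\<And>j. x j \<in> K"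
    "\<And>j. \<bar>(1 / real (n j)) * (\<Sum>k<n j. integral\<^sup>L (conv_pow_dirac a \<mu> k (x j)) f) - integral\<^sup>L m f\<bar> \<ge> \<epsilon>"
    by metis
  have pos: "0 < n j" for j using nx(1)[of j] by simp
  define N where "N j = walk_average (n j) (x j)" for j
  have far: "\<bar>integral\<^sup>L (N j) f - integral\<^sup>L m f\<bar> \<ge> \<epsilon>" for j
    unfolding N_def using nx(3)[of j] integral_walk_average[OF pos borel_measurable_continuous_onI[OF f(1)] B]
    by simp
  have n_lim: "filterlim n at_top sequentially"
    using nx(1) by (intro filterlim_at_top_mono[OF filterlim_Suc]) auto
  have tight: "\<exists>C. compact C \<and> eventually (\<lambda>j. 1 - d \<le> measure (N j) C) sequentially" if d: "d > 0" for d
  proof -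
    obtain n0 C where C: "compact C"
      "\<And>n x. n \<ge> n0 \<Longrightarrow> x \<in> K \<Longrightarrow> (1 / real n) * (\<Sum>k<n. measure (conv_pow_dirac a \<mu> k x) C) \<ge> 1 - d"
      using rec[unfolded lur_on_average_def, rule_format, OF K d] by blast
    have "C \<in> sets borel" using C(1) by (intro borel_closed compact_imp_closed)
    then have "1 - d \<le> measure (N j) C" if "j \<ge> n0" for j
      unfolding N_def using measure_walk_average[OF pos] C(2)[of "n j" "x j"] nx(1,2)[of j] that by simp
    then show ?thesis using C(1) by (auto simp: eventually_sequentially)
  qed
  have bp: "borel_prob (N j)" for j unfolding N_def by (rule borel_prob_walk_average)
  show False
  proof (rule prokhorov_subfilter[OF sequentially_bot bp tight])
    fix G \<nu> assume G: "G \<le> sequentially" "G \<noteq> bot" "borel_prob \<nu>"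
      and lim: "\<And>f :: 'x \<Rightarrow> real. continuous_on UNIV f \<Longrightarrow> bounded (range f) \<Longrightarrow>
         ((\<lambda>j. integral\<^sup>L (N j) f) \<longlongrightarrow> integral\<^sup>L \<nu> f) G"
    have "stationary a \<mu> \<nu>"
      by (rule stationary_limit_of_averages[OF G(2) filterlim_mono[OF n_lim order_refl G(1)] G(3)])
        (rule lim[unfolded N_def])
    then have "\<nu> = m" using ue G(3) by (simp add: uniquely_ergodic_def)
    then have "eventually (\<lambda>j. \<bar>integral\<^sup>L (N j) f - integral\<^sup>L m f\<bar> < \<epsilon>) G"
      using tendstoD[OF lim[OF f] e] by (simp add: dist_real_def)
    then have "eventually (\<lambda>_. False) G" by eventually_elim (use far in \<open>simp add: not_less[symmetric]\<close>)
    then show False using G(2) by (simp add: eventually_False)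
  qed
qed

end

lemma random_walkI:
  fixes a :: "'g::{topological_group_add, metric_space} \<Rightarrow> 'x::metric_space \<Rightarrow> 'x"
  assumes "lc_sigma_compact TYPE('g)" "lc_sigma_compact TYPE('x)" "continuous_action a" "borel_prob \<mu>"
  shows "random_walk a \<mu>"
proof -
  obtain A :: "'g set set" where A: "countable A" "topological_basis A"
    using assms(1) sigma_compact_imp_countable_basis unfolding lc_sigma_compact_def by metis
  obtain B :: "'x set set" where B: "countable B" "topological_basis B"
    using assms(2) sigma_compact_imp_countable_basis unfolding lc_sigma_compact_def by metis
  have cont: "continuous_on UNIV (\<lambda>(g, x). a g x)"
    using assms(3) by (simp add: continuous_action_def)
  have meas: "(\<lambda>(g, x). a g x) \<in> borel \<Otimes>\<^sub>M borel \<rightarrow>\<^sub>M borel"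
  proof (rule borel_measurableI)
    fix U :: "'x set" assume "open U"
    then have "open ((\<lambda>(g, x). a g x) -` U)" using cont by (rule open_vimage)
    then show "(\<lambda>(g, x). a g x) -` U \<inter> space (borel \<Otimes>\<^sub>M borel) \<in> sets (borel \<Otimes>\<^sub>M borel)"
      using open_in_sets_pair_borel[OF A B] by (simp add: space_pair_measure)
  qed
  show ?thesis
    using assms(4) unfolding borel_prob_def by (intro random_walk.intro cont meas) blast+
qed

lemma Cc_bounded:
  assumes "f \<in> Cc"
  shows "bounded (range f)"
proof -
  let ?S = "closure {x. f x \<noteq> 0}"
  have "compact (f ` ?S)"
    using assms by (intro compact_continuous_image) (auto simp: Cc_def intro: continuous_on_subset)
  then have "bounded (insert 0 (f ` ?S))" by (simp add: compact_imp_bounded)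
  moreover have "range f \<subseteq> insert 0 (f ` ?S)" using closure_subset by fastforce
  ultimately show ?thesis by (rule bounded_subset)
qed

theorem theorem4p4:
  fixes a :: "'g::{topological_group_add, metric_space} \<Rightarrow> 'x::metric_space \<Rightarrow> 'x"
    and \<mu> :: "'g measure" and m :: "'x measure"
  assumes "lc_sigma_compact TYPE('g)" and "lc_sigma_compact TYPE('x)"
    and "continuous_action a"
    and "borel_prob m" and "invariant_measure a m" and "ergodic_action a m"
    and "borel_prob \<mu>"
    and "uniquely_ergodic a \<mu> m"
    and "lur_on_average a \<mu>"
  shows "\<forall>f \<in> Cc. \<forall>K. compact K \<longrightarrow> (\<forall>\<epsilon>>0. \<exists>n0. \<forall>n\<ge>n0. \<forall>x\<in>K.
           \<bar>(1 / real n) * (\<Sum>k<n. integral\<^sup>L (conv_pow_dirac a \<mu> k x) f) - integral\<^sup>L m f\<bar> < \<epsilon>)"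
proof (intro ballI allI impI)
  fix f :: "'x \<Rightarrow> real" and K :: "'x set" and \<epsilon> :: real
  assume f: "f \<in> Cc" and K: "compact K" and \<epsilon>: "\<epsilon> > 0"
  interpret random_walk a \<mu> using assms by (intro random_walkI)
  show "\<exists>n0. \<forall>n\<ge>n0. \<forall>x\<in>K.
      \<bar>(1 / real n) * (\<Sum>k<n. integral\<^sup>L (conv_pow_dirac a \<mu> k x) f) - integral\<^sup>L m f\<bar> < \<epsilon>"
    using f by (intro averages_uniformly_convergent assms K \<epsilon> Cc_bounded) (auto simp: Cc_def)
qed

end
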